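(* Let $1\le m\le n$ and let $s,t\ge 1$ be integers. Then $$\#\{F \in \mathcal F(m,n) : \deg(0)=s \text{ and } \deg(p)=t\}$$ $$=\binom{m-2}{s-1,\,t-1,\,m-s-t}(n-m+1)^{s}(m-1)^{m-s-t+1}+\binom{m-1}{t-1,\,s-t,\,m-s}\,s\,(n-m+1)(n-m)^{s-t}m^{m-s-1}.$$
   Context: $\mathcal F(m,n)$ is the set of rooted forests with $n+1$ vertices and $m$ edges consisting of $n-m+1$ trees, whose roots are $n-m+1$ specified vertices labeled $01,02,\dots,0(n-m+1)$ and whose non-root vertices are labeled $1,\dots,m$. The degree of a vertex means its number of children. For $F\in\mathcal F(m,n)$, $\deg(0)$ is the sum of the degrees of all the roots $01,\dots,0(n-m+1)$, and $\deg(p)$ is the degree (number of children) of the parent $p$ of the vertex labeled $1$ (where $p$ may be a root). Conventions: $\binom{a}{b_1,b_2,b_3}=\frac{a!}{b_1!b_2!b_3!}$ is a multinomial coefficient; it is $0$ if some lower entry is negative, and then the whole corresponding term is $0$; $0^0=1$. *)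

theory Defs
  imports Complex_Main
begin

text \<open>A graph is given by its set of edges, each edge being a two-element set of vertices.
  A path is a nonempty list of distinct vertices; a single vertex is a path of length zero.\<close>

definition is_path :: "'a set set \<Rightarrow> 'a list \<Rightarrow> bool" where
  "is_path E p \<longleftrightarrow> p \<noteq> [] \<and> distinct p \<and> successively (\<lambda>u v. {u, v} \<in> E) p"

definition is_cycle :: "'a set set \<Rightarrow> 'a list \<Rightarrow> bool" where
  "is_cycle E p \<longleftrightarrow> is_path E p \<and> 3 \<le> length p \<and> {last p, hd p} \<in> E"

definition joined :: "'a set set \<Rightarrow> 'a \<Rightarrow> 'a \<Rightarrow> bool" where
  "joined E u v \<longleftrightarrow> (\<exists>p. is_path E p \<and> hd p = u \<and> last p = v)"

text \<open>An acyclic graph on \<open>V\<close> whose components (trees) contain exactly one element of the set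
  \<open>R\<close> of roots each; in particular there are \<open>card R\<close> trees.\<close>

definition rooted_forest :: "'a set \<Rightarrow> 'a set \<Rightarrow> 'a set set \<Rightarrow> bool" where
  "rooted_forest V R E \<longleftrightarrow>
     finite V \<and> R \<subseteq> V \<and>
     (\<forall>e\<in>E. e \<subseteq> V \<and> card e = 2) \<and>
     (\<nexists>p. is_cycle E p) \<and>
     (\<forall>v\<in>V. \<exists>!r. r \<in> R \<and> joined E r v)"

text \<open>The parent of \<open>v\<close> is the last vertex before \<open>v\<close> on the path from the root of its tree
  to \<open>v\<close>.\<close>

definition is_parent :: "'a set \<Rightarrow> 'a set set \<Rightarrow> 'a \<Rightarrow> 'a \<Rightarrow> bool" where
  "is_parent R E u v \<longleftrightarrow> (\<exists>p. is_path E (p @ [u, v]) \<and> hd (p @ [u]) \<in> R)"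

definition parent :: "'a set \<Rightarrow> 'a set set \<Rightarrow> 'a \<Rightarrow> 'a" where
  "parent R E v = (THE u. is_parent R E u v)"

definition deg :: "'a set \<Rightarrow> 'a set set \<Rightarrow> 'a \<Rightarrow> nat" where
  "deg R E u = card {v. is_parent R E u v}"

text \<open>\<open>Root i\<close> is the root vertex labelled \<open>0i\<close>, and \<open>Node i\<close> the non-root vertex labelled \<open>i\<close>.\<close>

datatype vertex = Root nat | Node nat

definition roots :: "nat \<Rightarrow> nat \<Rightarrow> vertex set" where
  "roots m n = Root ` {1..n - m + 1}"

definition vertices :: "nat \<Rightarrow> nat \<Rightarrow> vertex set" where
  "vertices m n = roots m n \<union> Node ` {1..m}"

definition forests :: "nat \<Rightarrow> nat \<Rightarrow> vertex set set set" where
  "forests m n = {F. rooted_forest (vertices m n) (roots m n) F \<and> card F = m}"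

definition deg_zero :: "nat \<Rightarrow> nat \<Rightarrow> vertex set set \<Rightarrow> nat" where
  "deg_zero m n F = (\<Sum>r\<in>roots m n. deg (roots m n) F r)"

definition deg_parent_one :: "nat \<Rightarrow> nat \<Rightarrow> vertex set set \<Rightarrow> nat" where
  "deg_parent_one m n F = deg (roots m n) F (parent (roots m n) F (Node 1))"

text \<open>The multinomial coefficient with three lower entries. The arguments are integers, since
  both the upper and the lower entries may be negative.\<close>

definition trinomial :: "int \<Rightarrow> int \<Rightarrow> int \<Rightarrow> int \<Rightarrow> real" where
  "trinomial a b c d =
     (if b < 0 \<or> c < 0 \<or> d < 0 then 0
      else fact (nat a) / (fact (nat b) * fact (nat c) * fact (nat d)))"

end

theory Submission
  imports Defs "HOL-Library.FuncSet"
begin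

text \<open>A rooted forest is the same as the map that sends every non-root to its parent, so the
  proposition becomes a count of acyclic maps \<open>f\<close> from the non-roots \<open>N\<close>, where
  \<open>card N = m\<close>, to \<open>N \<union> R\<close>, where \<open>card R = n - m + 1\<close>. The lemma \<open>bij_betw_map_graph\<close>
  makes this translation; degrees become sizes of fibres. Write \<open>p\<close> for the parent of vertex 1,
  \<open>T\<close> for the set of its \<open>t\<close> children, and \<open>S\<close> for the set of the \<open>s\<close> children of the
  roots. The two terms of the formula belong to the cases that \<open>p\<close> is not, or is, a root.

  Two bijections do the counting. Removing the roots splits a forest into an arbitrary map from
  \<open>S\<close> to \<open>R\<close> and a forest on \<open>N\<close> with root set \<open>S\<close> (\<open>bij_betw_first_level\<close>);
  iterating this proves Cayley's formula for forests with weighted vertices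
  (\<open>sum_weight_parent_maps\<close>). Contracting \<open>T\<close> into \<open>p\<close> removes \<open>t\<close> vertices and gives
  \<open>p\<close> the weight \<open>t\<close>, so that a prescribed set of children can be counted by the weighted
  formula (\<open>card_parent_maps_fibre\<close>).

  If \<open>p\<close> is a root, then \<open>T \<subseteq> S\<close>, the map from \<open>S\<close> to \<open>R\<close> has \<open>T\<close> as the fibre of
  \<open>p\<close>, and the forest below \<open>S\<close> is one of \<open>s * m powi (m - s - 1)\<close>. If \<open>p\<close> is not a root,
  then \<open>S\<close> and \<open>T\<close> are disjoint, the map from \<open>S\<close> to \<open>R\<close> is arbitrary, and the forest below
  \<open>S\<close> is contracted. The contracted count is proportional to the weight of \<open>S\<close>, and
  summing this weight over all \<open>S\<close> of size \<open>s\<close>, those that contain \<open>p\<close> and those that do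
  not, yields a multiple of the total weight \<open>m - 1\<close>.\<close>

section \<open>Forests as parent maps\<close>

text \<open>A rooted forest with roots \<open>R\<close> and non-roots \<open>N\<close>, written as the map that sends
  each non-root to its parent. On a finite \<open>N\<close>, every non-root leads to a root exactly when no
  nonempty subset of \<open>N\<close> is closed under the map. This form of acyclicity involves no iteration
  of the map, and it behaves well under restricting the map and identifying vertices.\<close>
definition parent_maps :: "'a set \<Rightarrow> 'a set \<Rightarrow> ('a \<Rightarrow> 'a) set" where
  "parent_maps N R = {f \<in> N \<rightarrow>\<^sub>E N \<union> R. \<forall>A\<subseteq>N. A \<noteq> {} \<longrightarrow> (\<exists>v\<in>A. f v \<notin> A)}"

lemma parent_mapsI:
  assumes "f \<in> N \<rightarrow>\<^sub>E N \<union> R"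
    and "\<And>A. A \<subseteq> N \<Longrightarrow> A \<noteq> {} \<Longrightarrow> f ` A \<subseteq> A \<Longrightarrow> False"
  shows "f \<in> parent_maps N R"
  using assms unfolding parent_maps_def by blast

lemma parent_mapsD:
  assumes "f \<in> parent_maps N R"
  shows "f \<in> N \<rightarrow>\<^sub>E N \<union> R"
    and "A \<subseteq> N \<Longrightarrow> A \<noteq> {} \<Longrightarrow> f ` A \<subseteq> A \<Longrightarrow> False"
  using assms unfolding parent_maps_def by blast+

lemma finite_parent_maps:
  assumes "finite N" "finite R"
  shows "finite (parent_maps N R)"
proof -
  have "finite (N \<rightarrow>\<^sub>E N \<union> R)" using assms by (intro finite_PiE) auto
  thus ?thesis unfolding parent_maps_def by simp
qed

text \<open>The number of proper ancestors of a vertex serves as its depth.\<close>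
lemma parent_maps_rank:
  fixes f :: "'a \<Rightarrow> 'a"
  assumes "f \<in> parent_maps N R" "finite N"
  obtains d :: "'a \<Rightarrow> nat" where "\<And>v. v \<in> N \<Longrightarrow> d (f v) < d v"
proof -
  define r where "r = {(f v, v) | v. v \<in> N}"
  have "wf r"
  proof (rule wfI_min)
    fix x :: 'a and Q assume x: "x \<in> Q"
    show "\<exists>z\<in>Q. \<forall>y. (y, z) \<in> r \<longrightarrow> y \<notin> Q"
    proof (cases "Q \<subseteq> N")
      case True
      then obtain v where "v \<in> Q" "f v \<notin> Q"
        using parent_mapsD(2)[OF assms(1) True] x by blast
      then show ?thesis unfolding r_def by blast
    next
      case False
      then show ?thesis unfolding r_def by blast
    qed
  qed
  hence ac: "acyclic r" by (rule wf_acyclic)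
  have "r = (\<lambda>v. (f v, v)) ` N" unfolding r_def by blast
  hence fin: "finite (r\<^sup>+)" using assms(2) by simp
  define d where "d v = card {u. (u, v) \<in> r\<^sup>+}" for v
  have "d (f v) < d v" if v: "v \<in> N" for v
    unfolding d_def
  proof (rule psubset_card_mono)
    have "{u. (u, v) \<in> r\<^sup>+} \<subseteq> fst ` r\<^sup>+" by force
    thus "finite {u. (u, v) \<in> r\<^sup>+}" using fin finite_surj by blast
    have e: "(f v, v) \<in> r" unfolding r_def using v by blast
    have "f v \<notin> {u. (u, f v) \<in> r\<^sup>+}" using ac by (simp add: acyclic_def)
    moreover have "f v \<in> {u. (u, v) \<in> r\<^sup>+}" using e by blast
    moreover have "{u. (u, f v) \<in> r\<^sup>+} \<subseteq> {u. (u, v) \<in> r\<^sup>+}"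
      using e by (auto intro: trancl_into_trancl)
    ultimately show "{u. (u, f v) \<in> r\<^sup>+} \<subset> {u. (u, v) \<in> r\<^sup>+}" by blast
  qed
  thus thesis using that by blast
qed

section \<open>The graph of a parent map\<close>

definition map_graph :: "'a set \<Rightarrow> ('a \<Rightarrow> 'a) \<Rightarrow> 'a set set" where
  "map_graph N f = (\<lambda>v. {v, f v}) ` N"

lemma joined_sym: "joined E u v \<Longrightarrow> joined E v u"
proof -
  assume "joined E u v"
  then obtain p where "is_path E p" "hd p = u" "last p = v" unfolding joined_def by blast
  hence "is_path E (rev p)" "hd (rev p) = v" "last (rev p) = u"
    unfolding is_path_def by (auto simp: insert_commute hd_rev last_rev)
  thus ?thesis unfolding joined_def by blast
qed

text \<open>If the new vertex already lies on the path, the path is cut there; this is why walks may be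
  used instead of paths.\<close>
lemma joined_step:
  assumes "joined E u v" "{v, w} \<in> E"
  shows "joined E u w"
proof -
  obtain p where p: "is_path E p" "hd p = u" "last p = v" using assms(1) unfolding joined_def by blast
  show ?thesis
  proof (cases "w \<in> set p")
    case True
    then obtain q q' where q: "p = q @ w # q'" by (meson split_list)
    have "is_path E (q @ [w])" using p(1) unfolding q is_path_def
      by (auto simp: successively_append_iff successively_Cons)
    moreover have "hd (q @ [w]) = u" using p(2) q by (cases q) auto
    ultimately show ?thesis unfolding joined_def by (metis last_snoc)
  next
    case False
    hence "is_path E (p @ [w])" "hd (p @ [w]) = u"
      using p assms(2) unfolding is_path_def by (auto simp: successively_append_iff)
    thus ?thesis unfolding joined_def by (metis last_snoc)
  qed
qed

lemma joined_trans:
  assumes "joined E u v" "joined E v w"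
  shows "joined E u w"
proof -
  obtain p where p: "is_path E p" "hd p = v" "last p = w" using assms(2) unfolding joined_def by blast
  have "successively (\<lambda>u v. {u, v} \<in> E) p" "p \<noteq> []" using p(1) unfolding is_path_def by auto
  hence "joined E u (last p)" using p(2)
  proof (induction p rule: rev_induct)
    case (snoc x xs)
    show ?case
    proof (cases "xs = []")
      case True
      then show ?thesis using snoc assms(1) by simp
    next
      case False
      hence "joined E u (last xs)" using snoc by (simp add: successively_append_iff)
      moreover have "{last xs, x} \<in> E" using snoc.prems False by (simp add: successively_append_iff)
      ultimately show ?thesis by (simp add: joined_step)
    qed
  qed simp
  thus ?thesis using p by simp
qed

lemma is_path_mono:
  assumes "is_path E p" "E \<subseteq> E'"
  shows "is_path E' p"
proof -
  have "successively (\<lambda>u v. {u, v} \<in> E) p" using assms(1) unfolding is_path_def by simp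
  hence "successively (\<lambda>u v. {u, v} \<in> E') p"
    by (rule successively_mono) (use assms(2) in blast)
  thus ?thesis using assms(1) unfolding is_path_def by simp
qed

lemma joined_mono: "joined E u v \<Longrightarrow> E \<subseteq> E' \<Longrightarrow> joined E' u v"
  unfolding joined_def using is_path_mono by blast

context
  fixes N R :: "'a set" and f :: "'a \<Rightarrow> 'a"
  assumes fN: "finite N" and fR: "finite R" and disj: "N \<inter> R = {}" and f: "f \<in> parent_maps N R"
begin

lemma map_graph_edge:
  assumes "{u, v} \<in> map_graph N f"
  shows "(v \<in> N \<and> f v = u) \<or> (u \<in> N \<and> f u = v)"
  using assms unfolding map_graph_def by (auto simp: doubleton_eq_iff)

lemma parent_neq: "v \<in> N \<Longrightarrow> f v \<noteq> v"
  using parent_mapsD(2)[OF f, of "{v}"] by auto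

text \<open>A path that leaves a root can only go away from it: the first edge does because a root has no
  parent, and an edge that went back up would return to the vertex visited just before.\<close>
lemma root_path_descends:
  assumes "is_path (map_graph N f) p" "hd p \<in> R"
  shows "successively (\<lambda>u v. v \<in> N \<and> f v = u) p"
  using assms
proof (induction p rule: rev_induct)
  case (snoc w p)
  show ?case
  proof (cases "p = []")
    case False
    have pth: "is_path (map_graph N f) p" and hd: "hd p \<in> R"
      using snoc.prems False unfolding is_path_def by (auto simp: successively_append_iff)
    have IH: "successively (\<lambda>u v. v \<in> N \<and> f v = u) p" by (rule snoc.IH[OF pth hd])
    have e: "{last p, w} \<in> map_graph N f" and w: "w \<notin> set p"
      using snoc.prems False unfolding is_path_def by (auto simp: successively_append_iff)
    have "\<not> (last p \<in> N \<and> f (last p) = w)"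
    proof
      assume *: "last p \<in> N \<and> f (last p) = w"
      obtain q x where q: "p = q @ [x]" using False by (metis rev_exhaust)
      have "q \<noteq> []" using * hd disj q by auto
      hence "f x = last q" using IH q by (simp add: successively_append_iff)
      thus False using * w q last_in_set[OF \<open>q \<noteq> []\<close>] by auto
    qed
    hence "w \<in> N \<and> f w = last p" using map_graph_edge[OF e] by blast
    thus ?thesis using IH by (simp add: successively_append_iff)
  qed simp
qed simp

text \<open>Read backwards, a descending path is forced: each vertex is followed by its parent until a root
  stops it.\<close>
lemma descending_root_unique:
  assumes "successively (\<lambda>u v. v \<in> N \<and> f v = u) p" "hd p \<in> R" "p \<noteq> []"
    and "successively (\<lambda>u v. v \<in> N \<and> f v = u) q" "hd q \<in> R" "q \<noteq> []"
    and "last p = last q"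
  shows "hd p = hd q"
  using assms
proof (induction p arbitrary: q rule: rev_induct)
  case (snoc x p)
  obtain q' where q': "q = q' @ [x]" using snoc.prems by (metis append_butlast_last_id last_snoc)
  show ?case
  proof (cases "p = []")
    case True
    hence "q' = []" using snoc.prems disj q' by (cases q' rule: rev_cases) (auto simp: successively_append_iff)
    thus ?thesis using True q' by simp
  next
    case False
    hence xN: "x \<in> N" using snoc.prems by (auto simp: successively_append_iff)
    hence "q' \<noteq> []" using snoc.prems(5) q' disj by auto
    hence "hd p = hd q'" using False snoc.prems q'
      by (intro snoc.IH) (auto simp: successively_append_iff)
    thus ?thesis using False \<open>q' \<noteq> []\<close> q' by simp
  qed
qed simp

lemma root_path_exists:
  assumes "v \<in> N \<union> R"
  obtains p where "is_path (map_graph N f) (p @ [v])" "hd (p @ [v]) \<in> R"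
    "v \<in> N \<Longrightarrow> p \<noteq> [] \<and> last p = f v"
proof -
  obtain d :: "'a \<Rightarrow> nat" where d: "\<And>v. v \<in> N \<Longrightarrow> d (f v) < d v"
    using parent_maps_rank[OF f fN] by blast
  \<comment> \<open>The bound on the depth makes the extended path distinct.\<close>
  have "\<exists>p. is_path (map_graph N f) (p @ [v]) \<and> hd (p @ [v]) \<in> R \<and>
      (v \<in> N \<longrightarrow> p \<noteq> [] \<and> last p = f v) \<and> (\<forall>u\<in>set p. d u < d v)"
    using assms
  proof (induction "d v" arbitrary: v rule: less_induct)
    case less
    show ?case
    proof (cases "v \<in> N")
      case False
      thus ?thesis using less.prems by (intro exI[of _ "[]"]) (auto simp: is_path_def)
    next
      case True
      have "f v \<in> N \<union> R" using True parent_mapsD(1)[OF f] by blast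
      then obtain p where p: "is_path (map_graph N f) (p @ [f v])" "hd (p @ [f v]) \<in> R"
        "\<forall>u\<in>set p. d u < d (f v)"
        using less.hyps[OF d[OF True]] by blast
      have "{f v, v} \<in> map_graph N f" unfolding map_graph_def using True by (auto simp: insert_commute)
      hence "is_path (map_graph N f) ((p @ [f v]) @ [v])"
        using p d[OF True] unfolding is_path_def by (force simp: successively_append_iff)
      moreover have "\<forall>u\<in>set (p @ [f v]). d u < d v" using p(3) d[OF True] by fastforce
      moreover have "hd ((p @ [f v]) @ [v]) \<in> R" using p(2) by (cases p) auto
      ultimately show ?thesis by (intro exI[of _ "p @ [f v]"]) simp
    qed
  qed
  thus thesis using that by blast
qed

lemma is_parent_map_graph:
  "is_parent R (map_graph N f) u v \<longleftrightarrow> v \<in> N \<and> f v = u"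
proof
  assume "is_parent R (map_graph N f) u v"
  then obtain p where p: "is_path (map_graph N f) (p @ [u, v])" "hd (p @ [u]) \<in> R"
    unfolding is_parent_def by blast
  have "hd (p @ [u, v]) \<in> R" using p(2) by (cases p) auto
  from root_path_descends[OF p(1) this] show "v \<in> N \<and> f v = u"
    by (auto simp: successively_append_iff)
next
  assume v: "v \<in> N \<and> f v = u"
  then obtain p where p: "is_path (map_graph N f) (p @ [v])" "hd (p @ [v]) \<in> R"
    "p \<noteq> [] \<and> last p = u"
    using root_path_exists[of v] by blast
  then obtain q where "p = q @ [u]" by (metis append_butlast_last_id)
  thus "is_parent R (map_graph N f) u v"
    unfolding is_parent_def using p by (intro exI[of _ q]) (cases q; auto)
qed

text \<open>A deepest vertex of a cycle would have both of its two distinct neighbours on the cycle as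
  parent.\<close>
lemma map_graph_no_cycle: "\<not> is_cycle (map_graph N f) p"
proof
  assume cyc: "is_cycle (map_graph N f) p"
  obtain d :: "'a \<Rightarrow> nat" where d: "\<And>v. v \<in> N \<Longrightarrow> d (f v) < d v"
    using parent_maps_rank[OF f fN] by blast
  define L where "L = length p"
  have L: "3 \<le> L" and dist: "distinct p"
    using cyc unfolding is_cycle_def is_path_def L_def by auto
  \<comment> \<open>Indices are taken modulo the length, so that the closing edge is treated like the others.\<close>
  have step: "{p ! i, p ! (Suc i mod L)} \<in> map_graph N f" if "i < L" for i
  proof (cases "Suc i < L")
    case True
    have "successively (\<lambda>u v. {u, v} \<in> map_graph N f) p" using cyc unfolding is_cycle_def is_path_def by auto
    thus ?thesis using True unfolding L_def by (simp add: successively_conv_nth)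
  next
    case False
    hence iL: "Suc i = L" using that by simp
    hence "i = L - 1" by simp
    moreover have "p \<noteq> []" using L L_def by auto
    ultimately have "p ! i = last p" "p ! (Suc i mod L) = hd p"
      using iL unfolding L_def by (simp_all add: last_conv_nth hd_conv_nth)
    thus ?thesis using cyc unfolding is_cycle_def by simp
  qed
  have "set p \<noteq> {}" using L L_def by auto
  hence "Max (d ` set p) \<in> d ` set p" by simp
  then obtain v where v: "v \<in> set p" "d v = Max (d ` set p)" by auto
  hence vmax: "d w \<le> d v" if "w \<in> set p" for w using that by simp
  obtain i where i: "i < L" "p ! i = v" using v(1) unfolding L_def by (meson in_set_conv_nth)
  have up: "f v = w" if "{v, w} \<in> map_graph N f" "w \<in> set p" for w
    using map_graph_edge[OF that(1)] d[of w] vmax[OF that(2)] by auto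
  define j where "j = (i + L - 1) mod L"
  have jL: "j < L" "Suc i mod L < L" using L unfolding j_def by auto
  have "Suc j mod L = i"
  proof -
    have "Suc j mod L = Suc (i + L - 1) mod L" unfolding j_def by (rule mod_Suc_eq)
    also have "Suc (i + L - 1) = i + L" using L by simp
    finally show ?thesis using i by simp
  qed
  hence "{p ! j, v} \<in> map_graph N f" using step[OF jL(1)] i by simp
  hence "f v = p ! j" using up[of "p ! j"] jL unfolding L_def by (simp add: insert_commute)
  moreover have "f v = p ! (Suc i mod L)" using up[of "p ! (Suc i mod L)"] step[OF i(1)] i jL unfolding L_def by simp
  ultimately have "j = Suc i mod L" using dist jL unfolding L_def by (simp add: nth_eq_iff_index_eq)
  hence "Suc (Suc i mod L) mod L = i" using \<open>Suc j mod L = i\<close> by simp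
  thus False using L i(1) by (auto simp: mod_Suc split: if_splits)
qed

lemma rooted_forest_map_graph: "rooted_forest (N \<union> R) R (map_graph N f)"
  unfolding rooted_forest_def
proof (intro conjI ballI)
  show "finite (N \<union> R)" using fN fR by simp
  fix e assume "e \<in> map_graph N f"
  then obtain v where v: "v \<in> N" "e = {v, f v}" unfolding map_graph_def by blast
  show "e \<subseteq> N \<union> R" using v PiE_mem[OF parent_mapsD(1)[OF f] v(1)] by blast
  show "card e = 2" using v parent_neq[OF v(1)] by simp
next
  show "\<nexists>p. is_cycle (map_graph N f) p" using map_graph_no_cycle by blast
  fix v assume "v \<in> N \<union> R"
  then obtain p where p: "is_path (map_graph N f) (p @ [v])" "hd (p @ [v]) \<in> R"
    using root_path_exists by blast
  show "\<exists>!r. r \<in> R \<and> joined (map_graph N f) r v"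
  proof (rule ex1I[of _ "hd (p @ [v])"])
    show "hd (p @ [v]) \<in> R \<and> joined (map_graph N f) (hd (p @ [v])) v"
      using p unfolding joined_def by (metis last_snoc)
    fix r assume r: "r \<in> R \<and> joined (map_graph N f) r v"
    then obtain q where q: "is_path (map_graph N f) q" "hd q = r" "last q = v" unfolding joined_def by blast
    show "r = hd (p @ [v])"
      using descending_root_unique[of q "p @ [v]"] root_path_descends[OF p] root_path_descends[OF q(1)]
        p q r unfolding is_path_def by auto
  qed
qed auto

text \<open>Two non-roots giving the same edge would be each other's parents.\<close>
lemma card_map_graph: "card (map_graph N f) = card N"
  unfolding map_graph_def
proof (rule card_image, rule inj_onI)
  fix u v assume uv: "u \<in> N" "v \<in> N" "{u, f u} = {v, f v}"
  show "u = v"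
  proof (rule ccontr)
    assume "u \<noteq> v"
    hence "f u = v" "f v = u" using uv(3) by (auto simp: doubleton_eq_iff)
    thus False using parent_mapsD(2)[OF f, of "{u, v}"] uv by auto
  qed
qed

end

text \<open>Orient the forest towards the roots: the parent of \<open>v\<close> is taken to be the last vertex but one
  on a shortest path from a root to \<open>v\<close>, so that parents are strictly closer to the roots. The
  resulting graph is a rooted forest inside \<open>E\<close>, and an edge of \<open>E\<close> missing from it would
  close a cycle, because its ends hang from the same root.\<close>
lemma parent_map_exists:
  assumes forest: "rooted_forest V R E"
  shows "\<exists>f\<in>parent_maps (V - R) R. map_graph (V - R) f = E"
proof -
  define N where "N = V - R"
  have fV: "finite V" and RV: "R \<subseteq> V" and edge: "\<And>e. e \<in> E \<Longrightarrow> e \<subseteq> V \<and> card e = 2"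
    and nocyc: "\<And>p. \<not> is_cycle E p" and root: "\<And>v. v \<in> V \<Longrightarrow> \<exists>!r. r \<in> R \<and> joined E r v"
    using forest unfolding rooted_forest_def by auto
  have NR: "N \<union> R = V" "N \<inter> R = {}" "finite N" "finite R"
    using RV fV finite_subset unfolding N_def by auto
  define Pth where "Pth v p \<longleftrightarrow> is_path E p \<and> hd p \<in> R \<and> last p = v" for v p
  define d where "d v = (LEAST l. \<exists>p. Pth v p \<and> length p = l)" for v
  have ex: "\<exists>p. Pth v p \<and> length p = d v" if v: "v \<in> V" for v
  proof -
    obtain p where "Pth v p" using root[OF v] unfolding joined_def Pth_def by blast
    hence "\<exists>l p. Pth v p \<and> length p = l" by blast
    thus ?thesis unfolding d_def by (rule LeastI_ex)
  qed
  have le: "d v \<le> length p" if "Pth v p" for v p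
    unfolding d_def using that by (intro Least_le) blast
  have step: "\<exists>u. u \<in> V \<and> {v, u} \<in> E \<and> d u < d v" if v: "v \<in> N" for v
  proof -
    obtain p where p: "Pth v p" "length p = d v" using ex v unfolding N_def by blast
    have "p \<noteq> []" using p unfolding Pth_def is_path_def by auto
    then obtain q where q: "p = q @ [v]" using p unfolding Pth_def by (metis append_butlast_last_id)
    have qne: "q \<noteq> []" using p q v unfolding Pth_def N_def by auto
    have e: "{v, last q} \<in> E" using p qne unfolding q Pth_def is_path_def
      by (auto simp: successively_append_iff insert_commute)
    have "Pth (last q) q" using p qne unfolding q Pth_def is_path_def by (auto simp: successively_append_iff)
    hence "d (last q) < d v" using le p(2) q by fastforce
    thus ?thesis using e edge[OF e] by auto
  qed
  define f where "f = (\<lambda>v\<in>N. SOME u. u \<in> V \<and> {v, u} \<in> E \<and> d u < d v)"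
  have fv: "f v \<in> V" "{v, f v} \<in> E" "d (f v) < d v" if "v \<in> N" for v
    using someI_ex[OF step[OF that]] that unfolding f_def by auto
  have fP: "f \<in> parent_maps N R"
  proof (rule parent_mapsI)
    show "f \<in> N \<rightarrow>\<^sub>E N \<union> R" using fv NR(1) unfolding f_def by (auto simp: PiE_iff)
    fix A assume A: "A \<subseteq> N" "A \<noteq> {}" "f ` A \<subseteq> A"
    then obtain a where "a \<in> A" by blast
    from ex_has_least_nat[of "\<lambda>v. v \<in> A", OF this, of d]
    obtain v where v: "v \<in> A" "\<forall>w. w \<in> A \<longrightarrow> d v \<le> d w" by blast
    moreover have "f v \<in> A" using A(3) v(1) by blast
    ultimately show False using A(1) fv(3)[of v] by fastforce
  qed
  let ?G = "map_graph N f"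
  have sub: "?G \<subseteq> E" unfolding map_graph_def using fv(2) by blast
  have rfG: "rooted_forest V R ?G"
    using rooted_forest_map_graph[OF NR(3,4,2) fP] NR(1) by simp
  have "E \<subseteq> ?G"
  proof (rule ccontr)
    assume "\<not> E \<subseteq> ?G"
    then obtain e where e: "e \<in> E" "e \<notin> ?G" by blast
    then obtain a b where ab: "e = {a, b}" "a \<noteq> b" using edge[OF e(1)] by (meson card_2_iff)
    have abV: "a \<in> V" "b \<in> V" using edge[OF e(1)] ab by auto
    obtain r where r: "r \<in> R" "joined ?G r a" using rfG abV unfolding rooted_forest_def by blast
    obtain r' where r': "r' \<in> R" "joined ?G r' b" using rfG abV unfolding rooted_forest_def by blast
    \<comment> \<open>The extra edge joins both ends to one root of \<open>E\<close>, so their roots in the subgraph agree.\<close>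
    have "joined E r b" using joined_step[of E r a b] joined_mono[OF r(2) sub] e ab by simp
    hence "r = r'" using root[OF abV(2)] joined_mono[OF r'(2) sub] r(1) r'(1) by blast
    hence "joined ?G a b" using joined_trans[OF joined_sym[OF r(2)]] r'(2) by blast
    then obtain p where p: "is_path ?G p" "hd p = a" "last p = b" unfolding joined_def by blast
    \<comment> \<open>A path with at most two vertices would be a loop or the missing edge itself.\<close>
    have "3 \<le> length p"
    proof (rule ccontr)
      assume "\<not> 3 \<le> length p"
      hence "length p = 0 \<or> length p = 1 \<or> length p = 2" by linarith
      thus False using p ab e unfolding is_path_def by (auto simp: length_Suc_conv numeral_2_eq_2)
    qed
    moreover have "is_path E p" using is_path_mono[OF p(1) sub] .
    moreover have "{last p, hd p} \<in> E" using p e ab by (simp add: insert_commute)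
    ultimately show False using nocyc unfolding is_cycle_def by blast
  qed
  thus ?thesis using sub fP unfolding N_def by blast
qed

lemma bij_betw_map_graph:
  assumes "finite N" "finite R" "N \<inter> R = {}"
  shows "bij_betw (map_graph N) (parent_maps N R) {E. rooted_forest (N \<union> R) R E \<and> card E = card N}"
proof (rule bij_betw_imageI)
  show "inj_on (map_graph N) (parent_maps N R)"
  proof (rule inj_onI)
    fix f g assume f: "f \<in> parent_maps N R" and g: "g \<in> parent_maps N R"
      and eq: "map_graph N f = map_graph N g"
    show "f = g"
    proof (rule PiE_ext)
      show "f \<in> N \<rightarrow>\<^sub>E N \<union> R" "g \<in> N \<rightarrow>\<^sub>E N \<union> R" using parent_mapsD(1) f g by blast+
      show "f v = g v" if "v \<in> N" for v
        using is_parent_map_graph[OF assms f, of "f v" v] is_parent_map_graph[OF assms g, of "f v" v] eq that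
        by simp
    qed
  qed
  have N: "N \<union> R - R = N" using assms(3) by auto
  show "map_graph N ` parent_maps N R = {E. rooted_forest (N \<union> R) R E \<and> card E = card N}"
    using rooted_forest_map_graph[OF assms] card_map_graph[OF assms] parent_map_exists[of "N \<union> R" R]
    unfolding N by fastforce
qed

lemma deg_map_graph:
  assumes "finite N" "finite R" "N \<inter> R = {}" "f \<in> parent_maps N R"
  shows "deg R (map_graph N f) u = card {v \<in> N. f v = u}"
  unfolding deg_def is_parent_map_graph[OF assms] ..

lemma parent_map_graph:
  assumes "finite N" "finite R" "N \<inter> R = {}" "f \<in> parent_maps N R" "v \<in> N"
  shows "parent R (map_graph N f) v = f v"
  unfolding parent_def is_parent_map_graph[OF assms(1-4)] using assms(5) by (intro the_equality) auto

section \<open>Removing the roots\<close>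

definition first_level :: "'a set \<Rightarrow> 'a set \<Rightarrow> ('a \<Rightarrow> 'a) \<Rightarrow> 'a set" where
  "first_level N R f = {v \<in> N. f v \<in> R}"

text \<open>Removing the roots turns their children \<open>S\<close> into the roots of a smaller forest. The two
  parts, where \<open>S\<close> attaches to \<open>R\<close> and how the rest hangs below \<open>S\<close>, are independent.\<close>
lemma bij_betw_first_level:
  assumes "N \<inter> R = {}" "S \<subseteq> N"
  shows "bij_betw (\<lambda>f. (restrict f S, restrict f (N - S)))
    {f \<in> parent_maps N R. first_level N R f = S} ((S \<rightarrow>\<^sub>E R) \<times> parent_maps (N - S) S)"
    (is "bij_betw ?c ?D ?E")
proof (rule bij_betw_byWitness[where f' = "\<lambda>(g, h). \<lambda>v\<in>N. if v \<in> S then g v else h v"])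
  let ?d = "\<lambda>(g, h). \<lambda>v\<in>N. if v \<in> S then g v else h v"
  show "\<forall>f\<in>?D. ?d (?c f) = f"
  proof
    fix f assume "f \<in> ?D"
    hence "f \<in> extensional N" using parent_mapsD(1)[of f N R] by (auto simp: PiE_def)
    thus "?d (?c f) = f" by (auto simp: fun_eq_iff restrict_def extensional_def)
  qed
  show "\<forall>e\<in>?E. ?c (?d e) = e"
  proof
    fix e assume "e \<in> ?E"
    then obtain g h where gh: "e = (g, h)" "g \<in> S \<rightarrow>\<^sub>E R" "h \<in> parent_maps (N - S) S" by auto
    hence "h \<in> extensional (N - S)" "g \<in> extensional S"
      using parent_mapsD(1)[of h "N - S" S] by (auto simp: PiE_def)
    thus "?c (?d e) = e" unfolding gh(1) using assms(2)
      by (auto simp: fun_eq_iff restrict_def extensional_def)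
  qed
  show "?c ` ?D \<subseteq> ?E"
  proof (rule image_subsetI)
    fix f assume "f \<in> ?D"
    hence f: "f \<in> parent_maps N R" and S: "S = {v \<in> N. f v \<in> R}" by (auto simp: first_level_def)
    have fm: "f v \<in> N \<union> R" if "v \<in> N" for v using PiE_mem[OF parent_mapsD(1)[OF f] that] .
    have "restrict f (N - S) \<in> parent_maps (N - S) S"
    proof (rule parent_mapsI)
      show "restrict f (N - S) \<in> (N - S) \<rightarrow>\<^sub>E (N - S) \<union> S" using fm S by (auto simp: PiE_iff)
      fix A assume A: "A \<subseteq> N - S" "A \<noteq> {}" "restrict f (N - S) ` A \<subseteq> A"
      hence "f ` A \<subseteq> A" by (auto simp: subset_iff image_iff)
      thus False using parent_mapsD(2)[OF f, of A] A by auto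
    qed
    moreover have "restrict f S \<in> S \<rightarrow>\<^sub>E R" using S by (auto simp: PiE_iff)
    ultimately show "?c f \<in> ?E" by simp
  qed
  show "?d ` ?E \<subseteq> ?D"
  proof (rule image_subsetI)
    fix e assume "e \<in> ?E"
    then obtain g h where gh: "e = (g, h)" "g \<in> S \<rightarrow>\<^sub>E R" "h \<in> parent_maps (N - S) S" by auto
    define f where "f = (\<lambda>v\<in>N. if v \<in> S then g v else h v)"
    have gm: "f v \<in> R" if "v \<in> S" for v
      using that assms(2) PiE_mem[OF gh(2) that] unfolding f_def by auto
    have hm: "f v = h v \<and> f v \<in> N" if "v \<in> N - S" for v
      using that assms(2) PiE_mem[OF parent_mapsD(1)[OF gh(3)] that] unfolding f_def by auto
    have "f \<in> parent_maps N R"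
    proof (rule parent_mapsI)
      have "f v \<in> N \<union> R" if "v \<in> N" for v using gm[of v] hm[of v] that by blast
      thus "f \<in> N \<rightarrow>\<^sub>E N \<union> R" by (auto simp: PiE_iff f_def)
      fix A assume A: "A \<subseteq> N" "A \<noteq> {}" "f ` A \<subseteq> A"
      hence "A \<subseteq> N - S" using gm assms(1) by blast
      moreover from this have "h ` A \<subseteq> A" using A(3) hm by fastforce
      ultimately show False using parent_mapsD(2)[OF gh(3)] A(2) by blast
    qed
    moreover have "first_level N R f = S" unfolding first_level_def using gm hm assms by blast
    moreover have "?d e = f" unfolding gh(1) f_def by simp
    ultimately show "?d e \<in> ?D" by simp
  qed
qed

lemma card_first_level:
  assumes "N \<inter> R = {}" "S \<subseteq> N"
  shows "card {f \<in> parent_maps N R. first_level N R f = S \<and> A (restrict f S) \<and> B (restrict f (N - S))} =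
    card {g \<in> S \<rightarrow>\<^sub>E R. A g} * card {h \<in> parent_maps (N - S) S. B h}"
proof -
  let ?c = "\<lambda>f. (restrict f S, restrict f (N - S))"
  have "bij_betw ?c {f \<in> parent_maps N R. first_level N R f = S \<and> A (restrict f S) \<and> B (restrict f (N - S))}
      ({g \<in> S \<rightarrow>\<^sub>E R. A g} \<times> {h \<in> parent_maps (N - S) S. B h})"
  proof (rule bij_betw_imageI)
    show "inj_on ?c {f \<in> parent_maps N R. first_level N R f = S \<and> A (restrict f S) \<and> B (restrict f (N - S))}"
      using bij_betw_imp_inj_on[OF bij_betw_first_level[OF assms]] by (rule inj_on_subset) auto
    have im: "?c ` {f \<in> parent_maps N R. first_level N R f = S} = (S \<rightarrow>\<^sub>E R) \<times> parent_maps (N - S) S"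
      by (rule bij_betw_imp_surj_on[OF bij_betw_first_level[OF assms]])
    have "{g \<in> S \<rightarrow>\<^sub>E R. A g} \<times> {h \<in> parent_maps (N - S) S. B h} =
        {e \<in> (S \<rightarrow>\<^sub>E R) \<times> parent_maps (N - S) S. A (fst e) \<and> B (snd e)}" by auto
    also have "\<dots> = ?c ` {f \<in> parent_maps N R. first_level N R f = S \<and> A (restrict f S) \<and> B (restrict f (N - S))}"
      unfolding im[symmetric] by auto
    finally show "?c ` {f \<in> parent_maps N R. first_level N R f = S \<and> A (restrict f S) \<and> B (restrict f (N - S))} =
      {g \<in> S \<rightarrow>\<^sub>E R. A g} \<times> {h \<in> parent_maps (N - S) S. B h}" by simp
  qed
  from bij_betw_same_card[OF this] show ?thesis by (simp only: card_cartesian_product)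
qed

lemma sum_weight_first_level:
  fixes x :: "'a \<Rightarrow> real"
  assumes "N \<inter> R = {}" "S \<subseteq> N" "finite N" "finite R"
  shows "(\<Sum>f | f \<in> parent_maps N R \<and> first_level N R f = S. \<Prod>v\<in>N. x (f v)) =
    sum x R ^ card S * (\<Sum>h\<in>parent_maps (N - S) S. \<Prod>v\<in>N - S. x (h v))"
proof -
  have fS: "finite S" using assms(2,3) by (rule finite_subset)
  let ?c = "\<lambda>f. (restrict f S, restrict f (N - S))"
  have "(\<Sum>f | f \<in> parent_maps N R \<and> first_level N R f = S. \<Prod>v\<in>N. x (f v)) =
      (\<Sum>f | f \<in> parent_maps N R \<and> first_level N R f = S.
        (\<lambda>(g, h). (\<Prod>v\<in>S. x (g v)) * (\<Prod>v\<in>N - S. x (h v))) (?c f))"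
    using assms(2,3) by (intro sum.cong) (simp_all add: prod.subset_diff[of S N] mult.commute)
  also have "\<dots> = (\<Sum>e\<in>(S \<rightarrow>\<^sub>E R) \<times> parent_maps (N - S) S.
        (\<lambda>(g, h). (\<Prod>v\<in>S. x (g v)) * (\<Prod>v\<in>N - S. x (h v))) e)"
    by (rule sum.reindex_bij_betw[OF bij_betw_first_level[OF assms(1,2)]])
  also have "\<dots> = (\<Sum>g\<in>S \<rightarrow>\<^sub>E R. \<Prod>v\<in>S. x (g v)) * (\<Sum>h\<in>parent_maps (N - S) S. \<Prod>v\<in>N - S. x (h v))"
    by (simp add: sum.cartesian_product[symmetric] sum_product)
  also have "(\<Sum>g\<in>S \<rightarrow>\<^sub>E R. \<Prod>v\<in>S. x (g v)) = sum x R ^ card S"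
    using prod_sum_PiE[of S "\<lambda>_. R" "\<lambda>_. x"] fS assms(4) by simp
  finally show ?thesis .
qed

lemma sum_card_fibres:
  assumes "finite N" "finite R"
  shows "(\<Sum>r\<in>R. card {v \<in> N. f v = r}) = card (first_level N R f)"
proof -
  have "card (first_level N R f) = card (\<Union>r\<in>R. {v \<in> N. f v = r})"
    by (rule arg_cong[where f = card]) (auto simp: first_level_def)
  also have "\<dots> = (\<Sum>r\<in>R. card {v \<in> N. f v = r})"
    using assms by (intro card_UN_disjoint) auto
  finally show ?thesis by simp
qed

section \<open>Cayley's formula with weights\<close>

lemma card_subsets_containing:
  assumes "finite M" "v \<in> M" "1 \<le> s"
  shows "card {S. S \<subseteq> M \<and> card S = s \<and> v \<in> S} = (card M - 1) choose (s - 1)"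
proof -
  have "bij_betw (insert v) {S. S \<subseteq> M - {v} \<and> card S = s - 1} {S. S \<subseteq> M \<and> card S = s \<and> v \<in> S}"
  proof (rule bij_betw_byWitness[where f' = "\<lambda>S. S - {v}"])
    show "insert v ` {S. S \<subseteq> M - {v} \<and> card S = s - 1} \<subseteq> {S. S \<subseteq> M \<and> card S = s \<and> v \<in> S}"
    proof (rule image_subsetI)
      fix S assume "S \<in> {S. S \<subseteq> M - {v} \<and> card S = s - 1}"
      moreover from this have "finite S" "v \<notin> S" using assms(1) finite_subset by auto
      ultimately show "insert v S \<in> {S. S \<subseteq> M \<and> card S = s \<and> v \<in> S}" using assms by auto
    qed
  qed (use assms in \<open>auto simp: card_Diff_singleton_if\<close>)
  hence "card {S. S \<subseteq> M \<and> card S = s \<and> v \<in> S} = card {S. S \<subseteq> M - {v} \<and> card S = s - 1}"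
    by (simp add: bij_betw_same_card)
  also have "\<dots> = (card M - 1) choose (s - 1)" using assms by (subst n_subsets) auto
  finally show ?thesis .
qed

lemma sum_subset_weights:
  fixes x :: "'a \<Rightarrow> real"
  assumes "finite M" "1 \<le> s"
  shows "(\<Sum>S | S \<subseteq> M \<and> card S = s. sum x S) = real ((card M - 1) choose (s - 1)) * sum x M"
proof -
  let ?A = "{S. S \<subseteq> M \<and> card S = s}"
  have fin: "finite ?A" using assms(1) by simp
  have "(\<Sum>S\<in>?A. sum x S) = (\<Sum>S\<in>?A. \<Sum>v\<in>{v. v \<in> M \<and> v \<in> S}. x v)"
    by (intro sum.cong refl) auto
  also have "\<dots> = (\<Sum>v\<in>M. \<Sum>S\<in>{S. S \<in> ?A \<and> v \<in> S}. x v)"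
    by (rule sum.swap_restrict[OF fin assms(1)])
  also have "\<dots> = (\<Sum>v\<in>M. real ((card M - 1) choose (s - 1)) * x v)"
    using card_subsets_containing[OF assms(1) _ assms(2)] by (intro sum.cong refl) (simp add: conj_assoc)
  finally show ?thesis by (simp add: sum_distrib_left)
qed

lemma parent_maps_no_nodes: "parent_maps {} R = {\<lambda>_. undefined}"
  unfolding parent_maps_def by auto

lemma parent_maps_no_roots: "N \<noteq> {} \<Longrightarrow> parent_maps N {} = {}"
  unfolding parent_maps_def by (auto simp: PiE_iff)

text \<open>The weighted form of Cayley's formula: with \<open>X\<close> the total weight of the roots and \<open>Y\<close> that
  of the non-roots, the forests, weighted by \<open>x v\<close> for every child of \<open>v\<close>, sum to
  \<open>X * (X + Y) ^ (card N - 1)\<close>. Multiplying by \<open>X + Y\<close> gives a form that includes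
  \<open>N = {}\<close>.

  The proof is by induction on the number of non-roots, removing the roots. The induction hypothesis
  for the children \<open>S\<close> of the roots contributes \<open>sum x S * Y ^ (card N - card S) / Y\<close>;
  averaging over the sets \<open>S\<close> of one size replaces \<open>sum x S\<close> by a multiple of \<open>Y\<close>, and
  the binomial theorem collects the sizes. Positive weights make \<open>Y\<close> cancellable.\<close>
theorem sum_weight_parent_maps:
  fixes x :: "'a \<Rightarrow> real"
  assumes "finite N" "finite R" "N \<inter> R = {}" "\<And>v. v \<in> N \<union> R \<Longrightarrow> 0 < x v"
  shows "sum x (N \<union> R) * (\<Sum>f\<in>parent_maps N R. \<Prod>v\<in>N. x (f v)) = sum x R * sum x (N \<union> R) ^ card N"
  using assms
proof (induction "card N" arbitrary: N R rule: less_induct)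
  case less
  note fN = less.prems(1) and fR = less.prems(2) and disj = less.prems(3) and pos = less.prems(4)
  show ?case
  proof (cases "N = {}")
    case True
    thus ?thesis by (simp add: parent_maps_no_nodes)
  next
    case False
    define W where "W N R = (\<Sum>f\<in>parent_maps N R. \<Prod>v\<in>N. x (f v))" for N R
    define X Y n where "X = sum x R" and "Y = sum x N" and "n = card N"
    have Y: "Y > 0" unfolding Y_def using False fN pos by (intro sum_pos) auto
    have n: "n \<ge> 1" unfolding n_def using False fN by (simp add: Suc_leI card_gt_0_iff)
    \<comment> \<open>For \<open>S = {}\<close> the induction hypothesis does not apply, but both sides vanish.\<close>
    have IH: "Y * W (N - S) S = sum x S * Y ^ (n - card S)" if S: "S \<subseteq> N" for S
    proof (cases "S = {}")
      case True
      thus ?thesis using False by (simp add: W_def parent_maps_no_roots)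
    next
      case F: False
      have "finite S" using S fN by (rule finite_subset)
      moreover have "card (N - S) < card N" using S F fN by (intro psubset_card_mono) auto
      moreover have "N - S \<union> S = N" using S by auto
      moreover have "card (N - S) = n - card S" using S \<open>finite S\<close> by (simp add: n_def card_Diff_subset)
      ultimately show ?thesis using less.hyps[of "N - S" S] fN pos
        S unfolding W_def Y_def by auto
    qed
    have "W N R = (\<Sum>S\<in>Pow N. \<Sum>f | f \<in> parent_maps N R \<and> first_level N R f = S. \<Prod>v\<in>N. x (f v))"
      unfolding W_def by (rule sum.group[symmetric]) (use finite_parent_maps[OF fN fR] fN in \<open>auto simp: first_level_def\<close>)
    also have "\<dots> = (\<Sum>S\<in>Pow N. X ^ card S * W (N - S) S)"
      unfolding W_def X_def using sum_weight_first_level[OF disj _ fN fR] by (intro sum.cong) auto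
    finally have "Y * W N R = (\<Sum>S\<in>Pow N. X ^ card S * (Y * W (N - S) S))"
      by (simp add: sum_distrib_left mult_ac)
    also have "\<dots> = (\<Sum>S\<in>Pow N. X ^ card S * Y ^ (n - card S) * sum x S)"
      using IH by (intro sum.cong) (auto simp: mult_ac)
    also have "\<dots> = (\<Sum>s\<in>{..n}. \<Sum>S | S \<in> Pow N \<and> card S = s. X ^ card S * Y ^ (n - card S) * sum x S)"
      by (rule sum.group[symmetric]) (use fN in \<open>auto simp: n_def card_mono\<close>)
    also have "\<dots> = (\<Sum>s\<in>{..n}. X ^ s * Y ^ (n - s) * (\<Sum>S | S \<subseteq> N \<and> card S = s. sum x S))"
      by (intro sum.cong refl) (simp add: sum_distrib_left)
    also have "{..n} = insert 0 (Suc ` {..n - 1})"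
      using n by (cases n) (simp_all add: atMost_Suc_eq_insert_0)
    also have "(\<Sum>s\<in>insert 0 (Suc ` {..n - 1}). X ^ s * Y ^ (n - s) * (\<Sum>S | S \<subseteq> N \<and> card S = s. sum x S)) =
        (\<Sum>j\<le>n - 1. X ^ Suc j * Y ^ (n - Suc j) * (\<Sum>S | S \<subseteq> N \<and> card S = Suc j. sum x S))"
    proof -
      have "{S. S \<subseteq> N \<and> card S = 0} = {{}}" using fN finite_subset by (auto simp: card_eq_0_iff)
      thus ?thesis by (subst sum.insert) (auto simp: sum.reindex)
    qed
    also have "\<dots> = (\<Sum>j\<le>n - 1. Y * X * (real ((n - 1) choose j) * X ^ j * Y ^ (n - 1 - j)))"
      using sum_subset_weights[OF fN, of "Suc _" x] unfolding n_def Y_def by (intro sum.cong refl) simp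
    also have "\<dots> = Y * (X * (X + Y) ^ (n - 1))"
      by (simp add: binomial_ring sum_distrib_left mult.assoc)
    finally have "W N R = X * (X + Y) ^ (n - 1)" using Y by simp
    moreover have "sum x (N \<union> R) = X + Y"
      unfolding X_def Y_def using fN fR disj by (simp add: sum.union_disjoint)
    moreover have "(X + Y) ^ n = (X + Y) * (X + Y) ^ (n - 1)" using n by (simp add: power_eq_if)
    ultimately show ?thesis unfolding W_def X_def n_def by simp
  qed
qed

lemma card_parent_maps:
  assumes "finite N" "finite R" "N \<inter> R = {}"
  shows "(card N + card R) * card (parent_maps N R) = card R * (card N + card R) ^ card N"
proof -
  have "real ((card N + card R) * card (parent_maps N R)) = real (card R * (card N + card R) ^ card N)"
    using sum_weight_parent_maps[OF assms, of "\<lambda>_. 1"] assms by (simp add: card_Un_disjoint)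
  thus ?thesis by (simp only: of_nat_eq_iff)
qed

section \<open>Contracting the children of a vertex\<close>

text \<open>Contract the prescribed set \<open>T\<close> of children of \<open>p\<close> into \<open>p\<close>. Every other child of the
  contracted vertex is in fact a child of one of the elements of \<open>T\<close>, since \<open>p\<close> itself has no
  children outside \<open>T\<close>; hence a contracted forest arises once for every assignment of these
  children to elements of \<open>T\<close>, which is a product of factors \<open>card T\<close>.\<close>
lemma card_parent_maps_fibre:
  assumes fN: "finite N" and fR: "finite R" and disj: "N \<inter> R = {}"
    and p: "p \<in> N \<union> R" and T: "T \<subseteq> N" and pT: "p \<notin> T"
  shows "card {f \<in> parent_maps N R. {v \<in> N. f v = p} = T} =
    (\<Sum>h\<in>parent_maps (N - T) R. \<Prod>v\<in>N - T. if h v = p then card T else 1)"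
proof -
  define D where "D = {f \<in> parent_maps N R. {v \<in> N. f v = p} = T}"
  define c where "c f = (\<lambda>u\<in>N - T. if f u \<in> T then p else f u)" for f
  define B where "B h u = (if u \<in> T then {p} else if h u = p then T else {h u})" for h :: "'a \<Rightarrow> 'a" and u
  have finD: "finite D" unfolding D_def using finite_parent_maps[OF fN fR] by simp
  \<comment> \<open>A closed set of the contracted map that contains \<open>p\<close> becomes closed under \<open>f\<close> when
    \<open>T\<close> is added; conversely, below, removing \<open>T\<close> from a closed set of \<open>f\<close> leaves a closed set.\<close>
  have cD: "c f \<in> parent_maps (N - T) R" if "f \<in> D" for f
  proof (rule parent_mapsI)
    have f: "f \<in> parent_maps N R" and fT: "{v \<in> N. f v = p} = T" using that unfolding D_def by auto
    show "c f \<in> (N - T) \<rightarrow>\<^sub>E (N - T) \<union> R"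
      using PiE_mem[OF parent_mapsD(1)[OF f]] p pT unfolding c_def by (auto simp: PiE_iff)
    fix A assume A: "A \<subseteq> N - T" "A \<noteq> {}" "c f ` A \<subseteq> A"
    have cA: "(if f u \<in> T then p else f u) \<in> A" if "u \<in> A" for u
    proof -
      have "c f u \<in> A" using A(3) that by blast
      thus ?thesis using A(1) that unfolding c_def by (auto split: if_splits)
    qed
    show False
    proof (cases "p \<in> A")
      case True
      have "f ` (A \<union> T) \<subseteq> A \<union> T" using cA fT True by (fastforce split: if_splits)
      thus False using parent_mapsD(2)[OF f, of "A \<union> T"] A T by blast
    next
      case False
      hence "f ` A \<subseteq> A" using cA by (metis image_subsetI)
      thus False using parent_mapsD(2)[OF f, of A] A by blast
    qed
  qed
  have fibre: "{f \<in> D. c f = h} = PiE N (B h)" if h: "h \<in> parent_maps (N - T) R" for h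
  proof (intro set_eqI iffI)
    fix f assume "f \<in> {f \<in> D. c f = h}"
    hence f: "f \<in> parent_maps N R" and fT: "{v \<in> N. f v = p} = T" and ch: "c f = h" unfolding D_def by auto
    have "f u \<in> B h u" if "u \<in> N" for u
      using fT that unfolding B_def ch[symmetric] c_def by auto
    moreover have "f \<in> extensional N" using parent_mapsD(1)[OF f] by (simp add: PiE_def)
    ultimately show "f \<in> PiE N (B h)" by (simp add: PiE_iff)
  next
    fix f assume fB: "f \<in> PiE N (B h)"
    have hm: "h u \<in> (N - T) \<union> R" if "u \<in> N - T" for u using PiE_mem[OF parent_mapsD(1)[OF h] that] .
    have fB': "f u \<in> B h u" if "u \<in> N" for u using PiE_mem[OF fB that] .
    have f1: "f u = p" if "u \<in> T" for u using fB'[of u] that T unfolding B_def by auto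
    have f2: "if h u = p then f u \<in> T else f u = h u \<and> f u \<notin> T" if "u \<in> N - T" for u
      using fB'[of u] hm[OF that] that T disj unfolding B_def by (auto split: if_splits)
    have "f \<in> parent_maps N R"
    proof (rule parent_mapsI)
      have "f u \<in> N \<union> R" if "u \<in> N" for u
        using f1[of u] f2[of u] hm[of u] that p T by (cases "u \<in> T") (auto split: if_splits)
      thus "f \<in> N \<rightarrow>\<^sub>E N \<union> R" using fB by (auto simp: PiE_iff)
      fix A assume A: "A \<subseteq> N" "A \<noteq> {}" "f ` A \<subseteq> A"
      have hA: "h u \<in> A - T" if u: "u \<in> A - T" for u
      proof (cases "h u = p")
        case True
        hence "f u \<in> A \<inter> T" using f2[of u] u A by auto
        hence "p \<in> A" using f1 A(3) by force
        thus ?thesis using True pT by simp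
      next
        case False
        moreover have "u \<in> N - T" "f u \<in> A" using u A(1,3) by blast+
        ultimately show ?thesis using f2[of u] by auto
      qed
      have "A - T \<noteq> {}" using A(2,3) f1 pT by fastforce
      thus False using parent_mapsD(2)[OF h, of "A - T"] A(1) hA by blast
    qed
    moreover have "{v \<in> N. f v = p} = T"
    proof (intro set_eqI iffI)
      fix v assume v: "v \<in> {v \<in> N. f v = p}"
      show "v \<in> T"
      proof (rule ccontr)
        assume "v \<notin> T"
        thus False using f2[of v] v pT by (auto split: if_splits)
      qed
    qed (use f1 T in auto)
    moreover have "c f = h"
    proof (rule PiE_ext)
      show "h \<in> (N - T) \<rightarrow>\<^sub>E (N - T) \<union> R" by (rule parent_mapsD(1)[OF h])
      show eq: "c f u = h u" if "u \<in> N - T" for u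
        using f2[OF that] that unfolding c_def by (auto split: if_splits)
      show "c f \<in> (N - T) \<rightarrow>\<^sub>E (N - T) \<union> R"
        using eq hm by (auto simp: PiE_iff c_def)
    qed
    ultimately show "f \<in> {f \<in> D. c f = h}" unfolding D_def by simp
  qed
  have "card D = (\<Sum>h\<in>parent_maps (N - T) R. card {f \<in> D. c f = h})"
    unfolding card_eq_sum
    by (rule sum.group[symmetric, OF finD]) (use cD finite_parent_maps[of "N - T" R] fN fR in auto)
  also have "\<dots> = (\<Sum>h\<in>parent_maps (N - T) R. \<Prod>v\<in>N. card (B h v))"
    using fibre by (intro sum.cong) (simp_all add: card_PiE fN)
  also have "\<dots> = (\<Sum>h\<in>parent_maps (N - T) R. \<Prod>v\<in>N - T. if h v = p then card T else 1)"
  proof (rule sum.cong[OF refl])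
    fix h
    have "(\<Prod>v\<in>N. card (B h v)) = (\<Prod>v\<in>N - T. card (B h v))"
      using T fN by (intro prod.mono_neutral_right) (auto simp: B_def)
    also have "\<dots> = (\<Prod>v\<in>N - T. if h v = p then card T else 1)"
      by (intro prod.cong) (auto simp: B_def)
    finally show "(\<Prod>v\<in>N. card (B h v)) = (\<Prod>v\<in>N - T. if h v = p then card T else 1)" .
  qed
  finally show ?thesis unfolding D_def .
qed

text \<open>The contracted forests are counted by the weighted Cayley formula with weight \<open>card T\<close> at
  \<open>p\<close> and \<open>1\<close> elsewhere; contraction removes \<open>card T\<close> vertices and adds
  \<open>card T - 1\<close> to the weight, whence the total weight \<open>card N + card R - 1\<close>.\<close>
lemma card_fibre_weighted:
  assumes fN: "finite N" and fR: "finite R" and disj: "N \<inter> R = {}"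
    and p: "p \<in> N \<union> R" and T: "T \<subseteq> N" and pT: "p \<notin> T" and T0: "T \<noteq> {}"
  shows "(card N + card R - 1) * card {f \<in> parent_maps N R. {v \<in> N. f v = p} = T} =
    (\<Sum>v\<in>R. if v = p then card T else 1) * (card N + card R - 1) ^ (card N - card T)"
proof -
  have finT: "finite T" using T fN by (rule finite_subset)
  define x where "x v = (if v = p then real (card T) else 1)" for v
  have pos: "0 < x v" for v using finT T0 by (simp add: x_def card_gt_0_iff)
  have cNT: "card (N - T) = card N - card T" "card T \<le> card N" using T finT fN by (simp_all add: card_Diff_subset card_mono)
  have cM: "card (N - T \<union> R) = card N - card T + card R"
    using fN fR disj cNT by (subst card_Un_disjoint) auto
  have pM: "p \<in> N - T \<union> R" using p pT by auto
  have "sum x (N - T \<union> R) = x p + sum x (N - T \<union> R - {p})"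
    using fN fR pM by (subst sum.remove[of _ p]) auto
  also have "sum x (N - T \<union> R - {p}) = real (card (N - T \<union> R - {p}))"
    by (simp add: x_def)
  also have "card (N - T \<union> R - {p}) = card N - card T + card R - 1" using cM pM by simp
  also have "x p + real (card N - card T + card R - 1) = real (card N + card R - 1)"
  proof -
    have "card N - card T + card R \<ge> 1" using cM pM fN fR
      by (metis One_nat_def Suc_leI card_gt_0_iff empty_iff finite_Diff finite_UnI)
    thus ?thesis using cNT(2) by (simp add: x_def of_nat_diff)
  qed
  finally have tot: "sum x (N - T \<union> R) = real (card N + card R - 1)" .
  have "real (card {f \<in> parent_maps N R. {v \<in> N. f v = p} = T}) =
      (\<Sum>h\<in>parent_maps (N - T) R. \<Prod>v\<in>N - T. x (h v))"
    unfolding card_parent_maps_fibre[OF fN fR disj p T pT] x_def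
    by (auto intro!: sum.cong prod.cong)
  hence "real ((card N + card R - 1) * card {f \<in> parent_maps N R. {v \<in> N. f v = p} = T}) =
      sum x R * real (card N + card R - 1) ^ (card N - card T)"
    using sum_weight_parent_maps[of "N - T" R x] fN fR disj pos unfolding tot cNT(1) by auto
  also have "sum x R = real (\<Sum>v\<in>R. if v = p then card T else 1)"
    unfolding x_def by (auto intro!: sum.cong)
  finally show ?thesis by (simp only: of_nat_power[symmetric] of_nat_mult[symmetric] of_nat_eq_iff)
qed

section \<open>The parent of a given vertex and its number of children\<close>

text \<open>The parent \<open>p\<close> of \<open>a\<close>, the set \<open>T\<close> of children of \<open>p\<close>, and the set \<open>S\<close> of
  children of the roots are determined by the forest; as \<open>a\<close> lies in \<open>T\<close>, the set \<open>T\<close>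
  forces \<open>p\<close> to be the parent of \<open>a\<close>.\<close>
lemma card_sorted_by_fibre:
  fixes s t :: nat
  assumes "finite N" "finite R" "finite P" "a \<in> N"
  shows "card {f \<in> parent_maps N R. f a \<in> P \<and> card (first_level N R f) = s \<and> card {v \<in> N. f v = f a} = t} =
    (\<Sum>p\<in>P. \<Sum>T | T \<subseteq> N \<and> card T = t \<and> a \<in> T. \<Sum>S | S \<subseteq> N \<and> card S = s.
      card {f \<in> parent_maps N R. first_level N R f = S \<and> {v \<in> N. f v = p} = T})"
proof -
  define D where "D = {f \<in> parent_maps N R. f a \<in> P \<and> card (first_level N R f) = s \<and> card {v \<in> N. f v = f a} = t}"
  define TT where "TT = {T. T \<subseteq> N \<and> card T = t \<and> a \<in> T}"
  define SS where "SS = {S. S \<subseteq> N \<and> card S = s}"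
  let ?g = "\<lambda>f. (f a, {v \<in> N. f v = f a}, first_level N R f)"
  have "card D = (\<Sum>y\<in>P \<times> TT \<times> SS. card {f \<in> D. ?g f = y})"
    unfolding card_eq_sum
  proof (rule sum.group[symmetric])
    show "finite D" unfolding D_def using finite_parent_maps[OF assms(1,2)] by simp
    show "finite (P \<times> TT \<times> SS)" using assms unfolding TT_def SS_def by simp
    show "?g ` D \<subseteq> P \<times> TT \<times> SS" using assms(4) unfolding D_def TT_def SS_def by (auto simp: first_level_def)
  qed
  also have "\<dots> = (\<Sum>(p, T, S)\<in>P \<times> TT \<times> SS. card {f \<in> parent_maps N R. first_level N R f = S \<and> {v \<in> N. f v = p} = T})"
  proof (intro sum.cong refl)
    fix y assume "y \<in> P \<times> TT \<times> SS"
    then obtain p T S where y: "y = (p, T, S)" "p \<in> P" "T \<in> TT" "S \<in> SS" by auto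
    have "{f \<in> D. ?g f = y} = {f \<in> parent_maps N R. first_level N R f = S \<and> {v \<in> N. f v = p} = T}"
      using y unfolding D_def TT_def SS_def by auto
    thus "card {f \<in> D. ?g f = y} =
      (case y of (p, T, S) \<Rightarrow> card {f \<in> parent_maps N R. first_level N R f = S \<and> {v \<in> N. f v = p} = T})"
      using y by simp
  qed
  finally show ?thesis unfolding D_def TT_def SS_def by (simp add: sum.cartesian_product[symmetric])
qed

text \<open>If the vertex with children \<open>T\<close> is a root \<open>r\<close>, the condition only concerns the attachment of
  \<open>S\<close>, where the elements of \<open>S\<close> outside \<open>T\<close> choose among the roots other than \<open>r\<close>.\<close>
lemma card_parent_of_root_fibre:
  assumes "finite N" "finite R" "N \<inter> R = {}" "S \<subseteq> N" "T \<subseteq> N" "r \<in> R"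
  shows "card {f \<in> parent_maps N R. first_level N R f = S \<and> {v \<in> N. f v = r} = T} =
    (if T \<subseteq> S then (card R - 1) ^ (card S - card T) * card (parent_maps (N - S) S) else 0)"
proof (cases "T \<subseteq> S")
  case True
  have fS: "finite S" "finite T" using assms finite_subset by blast+
  have "{f \<in> parent_maps N R. first_level N R f = S \<and> {v \<in> N. f v = r} = T} =
      {f \<in> parent_maps N R. first_level N R f = S \<and> {v \<in> S. restrict f S v = r} = T \<and> True}"
    using assms(4,6) unfolding first_level_def by auto
  hence "card {f \<in> parent_maps N R. first_level N R f = S \<and> {v \<in> N. f v = r} = T} =
      card {g \<in> S \<rightarrow>\<^sub>E R. {v \<in> S. g v = r} = T} * card (parent_maps (N - S) S)"
    using card_first_level[OF assms(3,4), where A = "\<lambda>g. {v \<in> S. g v = r} = T" and B = "\<lambda>_. True"] by simp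
  also have "{g \<in> S \<rightarrow>\<^sub>E R. {v \<in> S. g v = r} = T} = (\<Pi>\<^sub>E v\<in>S. if v \<in> T then {r} else R - {r})"
  proof (intro set_eqI iffI)
    fix g assume "g \<in> {g \<in> S \<rightarrow>\<^sub>E R. {v \<in> S. g v = r} = T}"
    thus "g \<in> (\<Pi>\<^sub>E v\<in>S. if v \<in> T then {r} else R - {r})" by (auto simp: PiE_iff)
  next
    fix g assume g: "g \<in> (\<Pi>\<^sub>E v\<in>S. if v \<in> T then {r} else R - {r})"
    have gv: "g v \<in> (if v \<in> T then {r} else R - {r})" if "v \<in> S" for v using PiE_mem[OF g that] .
    have eq: "g v = r \<longleftrightarrow> v \<in> T" if "v \<in> S" for v using gv[OF that] by (cases "v \<in> T") auto
    have "g v \<in> R" if "v \<in> S" for v using gv[OF that] assms(6) by (auto split: if_splits)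
    hence "g \<in> S \<rightarrow>\<^sub>E R" using g by (simp add: PiE_iff)
    moreover have "{v \<in> S. g v = r} = T" using eq True by auto
    ultimately show "g \<in> {g \<in> S \<rightarrow>\<^sub>E R. {v \<in> S. g v = r} = T}" by simp
  qed
  also have "card \<dots> = (\<Prod>v\<in>S. if v \<in> T then 1 else card R - 1)"
    using fS assms(2,6) by (subst card_PiE) (auto intro!: prod.cong)
  also have "\<dots> = (\<Prod>v\<in>S - T. card R - 1)"
    using fS by (intro prod.mono_neutral_cong_right) auto
  also have "\<dots> = (card R - 1) ^ (card S - card T)" using fS True by (simp add: card_Diff_subset)
  finally show ?thesis using True by simp
next
  case False
  hence "{f \<in> parent_maps N R. first_level N R f = S \<and> {v \<in> N. f v = r} = T} = {}"
    using assms(6) unfolding first_level_def by auto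
  thus ?thesis using False by (simp only: card.empty if_False)
qed

text \<open>If the vertex \<open>p\<close> with children \<open>T\<close> is not a root, the condition only concerns the forest
  below \<open>S\<close>. The vertex \<open>p\<close> may itself be a child of a root, and then its weight enters the
  sum over \<open>S\<close>.\<close>
lemma card_parent_of_node_fibre:
  assumes "finite N" "finite R" "N \<inter> R = {}" "S \<subseteq> N" "T \<subseteq> N" "T \<noteq> {}" "p \<in> N"
  shows "(card N - 1) * card {f \<in> parent_maps N R. first_level N R f = S \<and> {v \<in> N. f v = p} = T} =
    (if p \<notin> T \<and> S \<subseteq> N - T then card R ^ card S * (card N - 1) ^ (card N - card S - card T) *
        (\<Sum>v\<in>S. if v = p then card T else 1) else 0)"
proof (cases "p \<notin> T \<and> S \<subseteq> N - T")
  case True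
  have fS: "finite S" using assms finite_subset by blast
  have pR: "p \<notin> R" using assms by auto
  have "{f \<in> parent_maps N R. first_level N R f = S \<and> {v \<in> N. f v = p} = T} =
      {f \<in> parent_maps N R. first_level N R f = S \<and> True \<and> {v \<in> N - S. restrict f (N - S) v = p} = T}"
    using pR unfolding first_level_def by auto
  hence "card {f \<in> parent_maps N R. first_level N R f = S \<and> {v \<in> N. f v = p} = T} =
      card R ^ card S * card {h \<in> parent_maps (N - S) S. {v \<in> N - S. h v = p} = T}"
    using card_first_level[OF assms(3,4), where A = "\<lambda>_. True" and B = "\<lambda>h. {v \<in> N - S. h v = p} = T"] fS
    by (simp add: card_funcsetE)
  moreover have "card (N - S) = card N - card S" "card S \<le> card N"
    using fS assms by (simp_all add: card_Diff_subset card_mono)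
  moreover have "(card (N - S) + card S - 1) * card {h \<in> parent_maps (N - S) S. {v \<in> N - S. h v = p} = T} =
    (\<Sum>v\<in>S. if v = p then card T else 1) * (card (N - S) + card S - 1) ^ (card (N - S) - card T)"
    using True assms fS by (intro card_fibre_weighted) auto
  ultimately show ?thesis using True by (simp add: mult_ac)
next
  case False
  have "{f \<in> parent_maps N R. first_level N R f = S \<and> {v \<in> N. f v = p} = T} = {}"
  proof (rule equals0I)
    fix f assume "f \<in> {f \<in> parent_maps N R. first_level N R f = S \<and> {v \<in> N. f v = p} = T}"
    hence f: "f \<in> parent_maps N R" "{v \<in> N. f v \<in> R} = S" "{v \<in> N. f v = p} = T" by (auto simp: first_level_def)
    have "p \<notin> T" using parent_mapsD(2)[OF f(1), of "{p}"] f(3) assms(7) by auto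
    moreover have "S \<subseteq> N - T" using f(2,3) assms(3,7) by auto
    ultimately show False using False by simp
  qed
  thus ?thesis using False by (simp only: card.empty if_False mult_0_right)
qed

text \<open>Choose the root that is the parent of \<open>a\<close>, the set \<open>S\<close> containing \<open>a\<close>, the set \<open>T\<close>
  with \<open>a \<in> T \<subseteq> S\<close>, the parents of \<open>S - T\<close>, and a forest below \<open>S\<close>. The factor
  \<open>card N\<close> on the left clears the denominator in Cayley's formula for the last choice.\<close>
theorem card_parent_root:
  assumes "finite N" "finite R" "N \<inter> R = {}" "a \<in> N" "1 \<le> s" "1 \<le> t"
  shows "card N * card {f \<in> parent_maps N R. f a \<in> R \<and> card (first_level N R f) = s \<and> card {v \<in> N. f v = f a} = t} =
    card R * ((card N - 1) choose (s - 1)) * ((s - 1) choose (t - 1)) * (card R - 1) ^ (s - t) * s * card N ^ (card N - s)"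
    (is "_ * card ?D = _")
proof -
  define c where "c = (card R - 1) ^ (s - t) * (s * card N ^ (card N - s))"
  let ?TT = "{T. T \<subseteq> N \<and> card T = t \<and> a \<in> T}" and ?SS = "{S. S \<subseteq> N \<and> card S = s}"
  have fin: "finite ?TT" "finite ?SS" using assms(1) by simp_all
  have "card N * card ?D = (\<Sum>r\<in>R. \<Sum>T\<in>?TT. \<Sum>S\<in>?SS.
      card N * card {f \<in> parent_maps N R. first_level N R f = S \<and> {v \<in> N. f v = r} = T})"
    using card_sorted_by_fibre[OF assms(1,2,2,4), of s t] by (simp add: sum_distrib_left)
  also have "\<dots> = (\<Sum>r\<in>R. \<Sum>T\<in>?TT. \<Sum>S\<in>?SS. if T \<subseteq> S then c else 0)"
  proof (intro sum.cong refl)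
    fix r T S assume *: "r \<in> R" "T \<in> ?TT" "S \<in> ?SS"
    have fS: "finite S" using * assms(1) finite_subset by blast
    have "card (N - S) = card N - s" "s \<le> card N" using * fS assms(1) card_mono[of N S] by (auto simp: card_Diff_subset)
    hence "card N * card (parent_maps (N - S) S) = s * card N ^ (card N - s)"
      using card_parent_maps[of "N - S" S] fS assms(1) * by auto
    thus "card N * card {f \<in> parent_maps N R. first_level N R f = S \<and> {v \<in> N. f v = r} = T} = (if T \<subseteq> S then c else 0)"
      using card_parent_of_root_fibre[OF assms(1-3), of S T r] * unfolding c_def by (auto simp: mult_ac)
  qed
  also have "\<dots> = (\<Sum>r\<in>R. \<Sum>S\<in>?SS. \<Sum>T\<in>?TT. if T \<subseteq> S then c else 0)"
    by (intro sum.cong refl sum.swap)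
  also have "\<dots> = (\<Sum>r\<in>R. \<Sum>S\<in>?SS. if a \<in> S then ((s - 1) choose (t - 1)) * c else 0)"
  proof (intro sum.cong refl)
    fix S assume S: "S \<in> ?SS"
    have fS: "finite S" using S assms(1) finite_subset by blast
    have "(\<Sum>T\<in>?TT. if T \<subseteq> S then c else 0) = card {T \<in> ?TT. T \<subseteq> S} * c"
      using fin(1) by (simp add: sum.If_cases Int_def)
    also have "{T \<in> ?TT. T \<subseteq> S} = {T. T \<subseteq> S \<and> card T = t \<and> a \<in> T}" using S by auto
    also have "card \<dots> = (if a \<in> S then (s - 1) choose (t - 1) else 0)"
      using card_subsets_containing[OF fS _ assms(6), of a] S by (auto simp: card_eq_0_iff)
    finally show "(\<Sum>T\<in>?TT. if T \<subseteq> S then c else 0) = (if a \<in> S then ((s - 1) choose (t - 1)) * c else 0)" by simp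
  qed
  also have "\<dots> = card R * (card {S \<in> ?SS. a \<in> S} * (((s - 1) choose (t - 1)) * c))"
    using fin(2) by (simp add: sum.If_cases Int_def)
  also have "card {S \<in> ?SS. a \<in> S} = (card N - 1) choose (s - 1)"
    using card_subsets_containing[OF assms(1,4,5)] by (simp add: conj_assoc)
  finally show ?thesis unfolding c_def by (simp add: mult_ac)
qed

text \<open>After choosing \<open>p\<close> and its set of children \<open>T\<close>, the count depends on \<open>S\<close> only through its
  weight. The average of this weight over all \<open>S\<close> disjoint from \<open>T\<close> is proportional to the
  weight \<open>t + (card N - t - 1) = card N - 1\<close> of \<open>N - T\<close>. This absorbs the two cases of \<open>p\<close>
  being a child of a root or not, and it cancels the factor \<open>card N - 1\<close> of
  \<open>card_parent_of_node_fibre\<close>. The remaining factor \<open>card N - 1\<close> counts the vertices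
  \<open>p\<close> other than \<open>a\<close>.\<close>
theorem card_parent_node:
  assumes "finite N" "finite R" "N \<inter> R = {}" "a \<in> N" "1 \<le> s" "1 \<le> t" "s + t \<le> card N"
  shows "card {f \<in> parent_maps N R. f a \<in> N \<and> card (first_level N R f) = s \<and> card {v \<in> N. f v = f a} = t} =
    ((card N - 2) choose (t - 1)) * ((card N - t - 1) choose (s - 1)) * card R ^ s * (card N - 1) ^ (card N - s - t + 1)"
    (is "card ?D = _")
proof -
  define m where "m = card N"
  have m: "m \<ge> 2" using assms unfolding m_def by simp
  define c where "c = card R ^ s * (m - 1) ^ (m - s - t)"
  let ?TT = "{T. T \<subseteq> N \<and> card T = t \<and> a \<in> T}" and ?SS = "{S. S \<subseteq> N \<and> card S = s}"
  define x where "x p v = (if v = p then t else 1)" for p v :: 'a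
  have fin: "finite ?TT" "finite ?SS" using assms(1) by simp_all
  have "(m - 1) * card ?D = (\<Sum>p\<in>N. \<Sum>T\<in>?TT. \<Sum>S\<in>?SS.
      (m - 1) * card {f \<in> parent_maps N R. first_level N R f = S \<and> {v \<in> N. f v = p} = T})"
    using card_sorted_by_fibre[OF assms(1,2,1,4), of s t] by (simp add: sum_distrib_left)
  also have "\<dots> = (\<Sum>p\<in>N. \<Sum>T\<in>?TT. \<Sum>S\<in>?SS. if p \<notin> T \<and> S \<subseteq> N - T then c * sum (x p) S else 0)"
  proof (intro sum.cong refl)
    fix p T S assume *: "p \<in> N" "T \<in> ?TT" "S \<in> ?SS"
    hence T: "T \<noteq> {}" "T \<subseteq> N" and S: "S \<subseteq> N" and cards: "card T = t" "card S = s" by auto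
    show "(m - 1) * card {f \<in> parent_maps N R. first_level N R f = S \<and> {v \<in> N. f v = p} = T} =
        (if p \<notin> T \<and> S \<subseteq> N - T then c * sum (x p) S else 0)"
      using card_parent_of_node_fibre[OF assms(1-3) S T(2,1) *(1)]
      unfolding cards c_def m_def x_def by simp
  qed
  also have "\<dots> = (\<Sum>p\<in>N. \<Sum>T\<in>?TT. if p \<notin> T then c * (((m - t - 1) choose (s - 1)) * (m - 1)) else 0)"
  proof (intro sum.cong refl)
    fix p T assume *: "p \<in> N" "T \<in> ?TT"
    show "(\<Sum>S\<in>?SS. if p \<notin> T \<and> S \<subseteq> N - T then c * sum (x p) S else 0) =
        (if p \<notin> T then c * (((m - t - 1) choose (s - 1)) * (m - 1)) else 0)"
    proof (cases "p \<in> T")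
      case False
      have fT: "finite T" using * assms(1) finite_subset by blast
      have cNT: "card (N - T) = m - t" using * fT by (simp add: m_def card_Diff_subset)
      have pNT: "p \<in> N - T" using * False by simp
      have "(\<Sum>S\<in>?SS. if p \<notin> T \<and> S \<subseteq> N - T then c * sum (x p) S else 0) =
          (\<Sum>S\<in>{S \<in> ?SS. S \<subseteq> N - T}. c * sum (x p) S)"
        using fin(2) False by (simp add: sum.inter_filter[symmetric])
      also have "{S \<in> ?SS. S \<subseteq> N - T} = {S. S \<subseteq> N - T \<and> card S = s}" by auto
      also have "(\<Sum>S | S \<subseteq> N - T \<and> card S = s. c * sum (x p) S) =
          c * (\<Sum>S | S \<subseteq> N - T \<and> card S = s. sum (x p) S)" by (simp add: sum_distrib_left)
      also have "(\<Sum>S | S \<subseteq> N - T \<and> card S = s. sum (x p) S) = ((m - t - 1) choose (s - 1)) * sum (x p) (N - T)"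
      proof -
        have "real (\<Sum>S | S \<subseteq> N - T \<and> card S = s. sum (x p) S) = real (((m - t - 1) choose (s - 1)) * sum (x p) (N - T))"
          using sum_subset_weights[of "N - T" s "\<lambda>v. real (x p v)"] assms(1,5) cNT by simp
        thus ?thesis by (simp only: of_nat_eq_iff)
      qed
      also have "sum (x p) (N - T) = t + sum (x p) (N - T - {p})"
        using pNT assms(1) by (subst sum.remove[of _ p]) (auto simp: x_def)
      also have "sum (x p) (N - T - {p}) = card (N - T - {p})" by (simp add: x_def)
      also have "t + card (N - T - {p}) = m - 1" using cNT pNT assms by (simp add: m_def)
      finally show ?thesis using False by simp
    qed simp
  qed
  also have "\<dots> = (\<Sum>p\<in>N. card {T \<in> ?TT. p \<notin> T} * (c * (((m - t - 1) choose (s - 1)) * (m - 1))))"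
    using fin(1) by (simp add: sum.If_cases Int_def)
  also have "\<dots> = (\<Sum>p\<in>N - {a}. ((m - 2) choose (t - 1)) * (c * (((m - t - 1) choose (s - 1)) * (m - 1))))"
  proof (rule sum.mono_neutral_cong_right)
    have "{T \<in> ?TT. a \<notin> T} = {}" by auto
    thus "\<forall>p\<in>N - (N - {a}). card {T \<in> ?TT. p \<notin> T} * (c * (((m - t - 1) choose (s - 1)) * (m - 1))) = 0"
      by auto
    fix p assume p: "p \<in> N - {a}"
    have "{T \<in> ?TT. p \<notin> T} = {T. T \<subseteq> N - {p} \<and> card T = t \<and> a \<in> T}" by auto
    hence "card {T \<in> ?TT. p \<notin> T} = (m - 2) choose (t - 1)"
      using card_subsets_containing[of "N - {p}" a t] p assms by (auto simp: m_def numeral_2_eq_2)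
    thus "card {T \<in> ?TT. p \<notin> T} * (c * (((m - t - 1) choose (s - 1)) * (m - 1))) =
        ((m - 2) choose (t - 1)) * (c * (((m - t - 1) choose (s - 1)) * (m - 1)))" by simp
  qed (use assms in auto)
  also have "\<dots> = (m - 1) * (((m - 2) choose (t - 1)) * ((m - t - 1) choose (s - 1)) * card R ^ s * (m - 1) ^ (m - s - t + 1))"
    using assms by (simp add: m_def c_def mult_ac)
  finally show ?thesis using m unfolding m_def by simp
qed

text \<open>The children of the roots and the siblings of \<open>a\<close> are disjoint when the parent of \<open>a\<close> is
  not a root.\<close>
lemma no_parent_node:
  assumes "finite N" "finite R" "N \<inter> R = {}" "a \<in> N" "card N < s + t"
  shows "{f \<in> parent_maps N R. f a \<in> N \<and> card (first_level N R f) = s \<and> card {v \<in> N. f v = f a} = t} = {}"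
proof (rule equals0I)
  fix f assume f: "f \<in> {f \<in> parent_maps N R. f a \<in> N \<and> card (first_level N R f) = s \<and> card {v \<in> N. f v = f a} = t}"
  hence "card (first_level N R f \<union> {v \<in> N. f v = f a}) = s + t"
    using assms by (subst card_Un_disjoint) (auto simp: first_level_def)
  moreover have "card (first_level N R f \<union> {v \<in> N. f v = f a}) \<le> card N"
    using assms by (intro card_mono) (auto simp: first_level_def)
  ultimately show False using assms(5) by simp
qed

section \<open>Trinomial coefficients and the enumeration\<close>

lemma trinomial_swap: "trinomial a b c d = trinomial a c b d" "trinomial a b c d = trinomial a d b c"
  unfolding trinomial_def by (auto simp: mult_ac)

lemma trinomial_eq_binomials:
  assumes "n = b + c + d"
  shows "trinomial (int n) (int b) (int c) (int d) = real ((n choose b) * ((n - b) choose c))"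
proof -
  have "real (n choose b) = fact n / (fact b * fact (c + d))"
    using assms by (subst binomial_fact) (auto simp: add.commute)
  moreover have "real ((n - b) choose c) = fact (c + d) / (fact c * fact d)"
    using assms by (subst binomial_fact) auto
  ultimately show ?thesis unfolding trinomial_def by simp
qed

theorem proposition4p2:
  fixes m n s t :: nat
  assumes "1 \<le> m" and "m \<le> n" and "1 \<le> s" and "1 \<le> t"
  shows "real (card {F \<in> forests m n. deg_zero m n F = s \<and> deg_parent_one m n F = t}) =
      trinomial (int m - 2) (int s - 1) (int t - 1) (int m - int s - int t)
        * (real n - real m + 1) powi int s
        * (real m - 1) powi (int m - int s - int t + 1)
    + trinomial (int m - 1) (int t - 1) (int s - int t) (int m - int s)
        * real s * (real n - real m + 1)
        * (real n - real m) powi (int s - int t)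
        * real m powi (int m - int s - 1)"
proof -
  define N where "N = Node ` {1..m}"
  define R where "R = roots m n"
  define D where "D P = {f \<in> parent_maps N R. f (Node 1) \<in> P \<and> card (first_level N R f) = s \<and>
    card {v \<in> N. f v = f (Node 1)} = t}" for P
  have fin: "finite N" "finite R" and disj: "N \<inter> R = {}" and one: "Node 1 \<in> N"
    using assms unfolding N_def R_def roots_def by auto
  have cN: "card N = m" unfolding N_def by (subst card_image) (auto simp: inj_on_def)
  have cR: "card R = n - m + 1" unfolding R_def roots_def by (subst card_image) (auto simp: inj_on_def)
  have finD: "finite (D P)" for P unfolding D_def using finite_parent_maps[OF fin] by simp

  \<comment> \<open>Pass from forests to parent maps, and separate them by whether the parent of vertex 1 is a root.\<close>
  have bij: "bij_betw (map_graph N) (parent_maps N R) (forests m n)"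
    using bij_betw_map_graph[OF fin disj] unfolding forests_def vertices_def cN N_def[symmetric] R_def[symmetric]
    by (simp add: Un_commute)
  have degs: "deg_zero m n (map_graph N f) = s \<and> deg_parent_one m n (map_graph N f) = t \<longleftrightarrow>
      card (first_level N R f) = s \<and> card {v \<in> N. f v = f (Node 1)} = t" if f: "f \<in> parent_maps N R" for f
    unfolding deg_zero_def deg_parent_one_def R_def[symmetric]
    using deg_map_graph[OF fin disj f] parent_map_graph[OF fin disj f one] sum_card_fibres[OF fin, of f]
    by simp
  have "bij_betw (map_graph N) (D (N \<union> R))
      {F \<in> forests m n. deg_zero m n F = s \<and> deg_parent_one m n F = t}"
  proof (rule bij_betw_imageI)
    show "inj_on (map_graph N) (D (N \<union> R))"
      using bij_betw_imp_inj_on[OF bij] by (rule inj_on_subset) (auto simp: D_def)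
    have "f (Node 1) \<in> N \<union> R" if "f \<in> parent_maps N R" for f
      using PiE_mem[OF parent_mapsD(1)[OF that] one] .
    thus "map_graph N ` D (N \<union> R) = {F \<in> forests m n. deg_zero m n F = s \<and> deg_parent_one m n F = t}"
      using degs unfolding D_def bij_betw_imp_surj_on[OF bij, symmetric] by auto
  qed
  hence "card {F \<in> forests m n. deg_zero m n F = s \<and> deg_parent_one m n F = t} = card (D (N \<union> R))"
    by (simp add: bij_betw_same_card)
  also have "D (N \<union> R) = D N \<union> D R" unfolding D_def by blast
  also have "card (D N \<union> D R) = card (D N) + card (D R)"
    using finD disj by (intro card_Un_disjoint) (auto simp: D_def)
  finally have split: "real (card {F \<in> forests m n. deg_zero m n F = s \<and> deg_parent_one m n F = t}) =
      real (card (D N)) + real (card (D R))" by simp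

  have "real (card (D N)) = trinomial (int m - 2) (int s - 1) (int t - 1) (int m - int s - int t)
        * (real n - real m + 1) powi int s * (real m - 1) powi (int m - int s - int t + 1)"
  proof (cases "s + t \<le> m")
    case True
    have "trinomial (int m - 2) (int s - 1) (int t - 1) (int m - int s - int t) =
        trinomial (int (m - 2)) (int (t - 1)) (int (s - 1)) (int (m - s - t))"
    proof -
      have "int (m - 2) = int m - 2" "int (t - 1) = int t - 1" "int (s - 1) = int s - 1"
        "int (m - s - t) = int m - int s - int t" using True assms by simp_all
      thus ?thesis by (simp only: trinomial_swap(1)[of "int m - 2" "int s - 1"])
    qed
    also have "\<dots> = real (((m - 2) choose (t - 1)) * ((m - t - 1) choose (s - 1)))"
      using True assms by (subst trinomial_eq_binomials) auto
    finally have tri: "trinomial (int m - 2) (int s - 1) (int t - 1) (int m - int s - int t) =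
        real (((m - 2) choose (t - 1)) * ((m - t - 1) choose (s - 1)))" .
    have "int m - int s - int t + 1 = int (m - s - t + 1)" using True by simp
    hence pw: "(real m - 1) powi (int m - int s - int t + 1) = real (m - 1) ^ (m - s - t + 1)"
      using assms(1) by (simp only: power_int_of_nat) simp
    have k: "real n - real m + 1 = real (n - m + 1)" using assms(2) by simp
    have "card (D N) = ((m - 2) choose (t - 1)) * ((m - t - 1) choose (s - 1)) * (n - m + 1) ^ s *
        (m - 1) ^ (m - s - t + 1)"
      using card_parent_node[OF fin disj one assms(3,4)] True unfolding D_def cN cR by simp
    thus ?thesis unfolding tri pw k by (simp only: power_int_of_nat of_nat_mult of_nat_power)
  next
    case False
    hence "D N = {}" using no_parent_node[OF fin disj one, of s t] unfolding D_def cN by simp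
    moreover have "trinomial (int m - 2) (int s - 1) (int t - 1) (int m - int s - int t) = 0"
      using False unfolding trinomial_def by simp
    ultimately show ?thesis by simp
  qed
  moreover have "real (card (D R)) = trinomial (int m - 1) (int t - 1) (int s - int t) (int m - int s)
        * real s * (real n - real m + 1) * (real n - real m) powi (int s - int t)
        * real m powi (int m - int s - 1)"
  proof -
    have "m * card (D R) = (n - m + 1) * ((m - 1) choose (s - 1)) * ((s - 1) choose (t - 1)) *
        (n - m) ^ (s - t) * s * m ^ (m - s)"
      using card_parent_root[OF fin disj one assms(3,4)] unfolding D_def cN cR by simp
    hence eq: "real m * real (card (D R)) = real ((n - m + 1) * ((m - 1) choose (s - 1)) *
        ((s - 1) choose (t - 1)) * (n - m) ^ (s - t) * s * m ^ (m - s))"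
      by (simp only: of_nat_mult[symmetric])
    show ?thesis
    proof (cases "t \<le> s \<and> s \<le> m")
      case True
      have "trinomial (int m - 1) (int t - 1) (int s - int t) (int m - int s) =
          trinomial (int (m - 1)) (int (m - s)) (int (t - 1)) (int (s - t))"
      proof -
        have "int (m - 1) = int m - 1" "int (m - s) = int m - int s" "int (t - 1) = int t - 1"
          "int (s - t) = int s - int t" using True assms by simp_all
        thus ?thesis by (simp only: trinomial_swap(2)[of "int m - 1" "int t - 1"])
      qed
      also have "\<dots> = real (((m - 1) choose (m - s)) * ((s - 1) choose (t - 1)))"
        using True assms by (subst trinomial_eq_binomials) auto
      also have "(m - 1) choose (m - s) = (m - 1) choose (s - 1)"
        using True assms by (subst binomial_symmetric) auto
      finally have tri: "trinomial (int m - 1) (int t - 1) (int s - int t) (int m - int s) =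
          real (((m - 1) choose (s - 1)) * ((s - 1) choose (t - 1)))" .
      have "int s - int t = int (s - t)" "real n - real m = real (n - m)" using True assms by auto
      hence pw: "(real n - real m) powi (int s - int t) = real (n - m) ^ (s - t)"
        by (simp only: power_int_of_nat)
      have ms: "int m - int s - 1 = int (m - s) - 1" using True by simp
      have pm: "real m powi (int m - int s - 1) = real m ^ (m - s) / real m"
        unfolding ms using assms(1) by (subst power_int_diff) simp_all
      have k: "real n - real m + 1 = real (n - m + 1)" using assms(2) by simp
      \<comment> \<open>\<open>eq\<close> has the factor \<open>m\<close> on the left where the goal has the exponent \<open>m - s - 1\<close>.\<close>
      have "real (card (D R)) = real m * real (card (D R)) / real m" using assms(1) by simp
      thus ?thesis unfolding tri pw pm k eq
        by (simp only: of_nat_mult of_nat_power times_divide_eq_right mult_ac)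
    next
      case False
      hence "((m - 1) choose (s - 1)) * ((s - 1) choose (t - 1)) = 0" using assms by auto
      hence "real (card (D R)) = 0" using eq assms(1) by (auto simp: binomial_eq_0)
      moreover have "trinomial (int m - 1) (int t - 1) (int s - int t) (int m - int s) = 0"
        using False unfolding trinomial_def by auto
      ultimately show ?thesis by simp
    qed
  qed
  ultimately show ?thesis using split by simp
qed

end
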